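(* Let $S_0$ and $S_1$ be positive semidefinite complex $d\times d$ matrices such that $S_1$ is an optimal matching matrix for $S_0$, i.e. $\lambda(S_0+S_1)=\big(\lambda(S_0)+\lambda^\uparrow(S_1)\big)^\downarrow$. Let $\lambda=\lambda(S_0)$ and $\mu=\lambda^\uparrow(S_1)$. Then there exists an orthonormal basis $\{v_i\}_{i=1}^d$ of $\mathbb C^d$ with $S_0v_i=\lambda_iv_i$ for every $1\le i\le d$ such that $$S_1=\sum_{i=1}^d\mu_i\,v_i\otimes v_i\quad\text{and}\quad S_0+S_1=\sum_{i=1}^d(\lambda_i+\mu_i)\,v_i\otimes v_i.$$
   Context: For a self-adjoint $d\times d$ matrix $S$, $\lambda(S)\in\mathbb R^d$ is the vector of its eigenvalues, counted with multiplicity, in decreasing order, and $\lambda^\uparrow(S)$ is the same vector in increasing order. For $x\in\mathbb R^d$, $x^\downarrow$ is its decreasing rearrangement. $x\otimes y$ denotes the operator $z\mapsto\langle z,y\rangle x$. *)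

theory Defs
  imports
    "HOL-Computational_Algebra.Polynomial"
    "HOL-Algebra.Ring"
    "Jordan_Normal_Form.Char_Poly"
    "Jordan_Normal_Form.Schur_Decomposition"
    "Jordan_Normal_Form.VS_Connect"
begin

definition self_adjoint :: "nat \<Rightarrow> complex mat \<Rightarrow> bool" where
  "self_adjoint d S \<longleftrightarrow> S \<in> carrier_mat d d \<and> mat_adjoint S = S"

text \<open>The inner product \<open>\<bullet>c\<close> is linear in its first and conjugate linear in its second argument.
  For self-adjoint \<open>S\<close> the values \<open>(S *\<^sub>v x) \<bullet>c x\<close> are real, so \<open>Re\<close> loses nothing.\<close>

definition pos_semidef :: "nat \<Rightarrow> complex mat \<Rightarrow> bool" where
  "pos_semidef d S \<longleftrightarrow>
     self_adjoint d S \<and> (\<forall>x \<in> carrier_vec d. 0 \<le> Re ((S *\<^sub>v x) \<bullet>c x))"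

text \<open>Vectors of \<open>\<real>\<^sup>d\<close> holding eigenvalues are lists of length \<open>d\<close>, indexed from \<open>0\<close>. The
  multiset \<open>proots (char_poly S)\<close> holds the eigenvalues with multiplicity; they are real
  when \<open>S\<close> is self-adjoint, the only case of interest, so \<open>Re\<close> is just the change of type.\<close>

definition eigvals_incr :: "complex mat \<Rightarrow> real list" where
  "eigvals_incr S = sorted_list_of_multiset (image_mset Re (proots (char_poly S)))"

definition eigvals_decr :: "complex mat \<Rightarrow> real list" where
  "eigvals_decr S = rev (eigvals_incr S)"

definition decr_rearr :: "real list \<Rightarrow> real list" where
  "decr_rearr xs = rev (sort xs)"

definition optimal_matching :: "complex mat \<Rightarrow> complex mat \<Rightarrow> bool" where
  "optimal_matching S0 S1 \<longleftrightarrow>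
     eigvals_decr (S0 + S1) = decr_rearr (map2 (+) (eigvals_decr S0) (eigvals_incr S1))"

definition outer :: "complex vec \<Rightarrow> complex vec \<Rightarrow> complex mat" where
  "outer x y = mat (dim_vec x) (dim_vec y) (\<lambda>(i, j). x $ i * cnj (y $ j))"

lemma outer_mult_vec:
  assumes "dim_vec z = dim_vec y"
  shows "outer x y *\<^sub>v z = (z \<bullet>c y) \<cdot>\<^sub>v x"
  using assms
  by (intro eq_vecI)
     (auto simp: outer_def scalar_prod_def sum_distrib_left sum_distrib_right ac_simps)

definition orthonormal_basis :: "nat \<Rightarrow> (nat \<Rightarrow> complex vec) \<Rightarrow> bool" where
  "orthonormal_basis d v \<longleftrightarrow>
     (\<forall>i<d. v i \<in> carrier_vec d) \<and>
     (\<forall>i<d. \<forall>j<d. v i \<bullet>c v j = (if i = j then 1 else 0)) \<and>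
     vectorspace.basis class_ring (module_vec TYPE(complex) d) (v ` {..<d})"

lemma length_eigvals:
  assumes "S \<in> carrier_mat d d"
  shows "length (eigvals_incr S) = d" and "length (eigvals_decr S) = d"
proof -
  obtain as where as: "char_poly S = (\<Prod>a\<leftarrow>as. [:- a, 1:])" "length as = d"
    using char_poly_factorized[OF assms] by blast
  have "proots (\<Prod>a\<leftarrow>as. [:- a, 1:]) = mset as"
  proof (induction as)
    case (Cons a as)
    have "(\<Prod>a\<leftarrow>as. [:- a, 1:]) \<noteq> (0 :: complex poly)"
      by (auto simp: prod_list_zero_iff)
    then show ?case
      using Cons by (simp add: proots_mult del: mult_pCons_left)
  qed simp
  then have "size (image_mset Re (proots (char_poly S))) = d"
    using as by simp
  then have "length (eigvals_incr S) = d"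
    unfolding eigvals_incr_def by (metis mset_sorted_list_of_multiset size_mset)
  then show "length (eigvals_incr S) = d" and "length (eigvals_decr S) = d"
    by (simp_all add: eigvals_decr_def)
qed

end

theory Submission
  imports Defs "HOL-Combinatorics.List_Permutation" "Jordan_Normal_Form.Spectral_Radius"
begin

text \<open>
  Optimality of the matching is exploited through second moments. For a self-adjoint matrix
  \<open>S\<close> the sum \<open>\<Sum>\<^sub>i \<parallel>S u\<^sub>i\<parallel>\<^sup>2\<close> is the same for all orthonormal bases \<open>u\<close>; in an eigenbasis it is the
  sum of the squared eigenvalues. Let \<open>u\<close> and \<open>w\<close> be eigenbases of \<open>S\<^sub>0\<close> and \<open>S\<^sub>1\<close> for the
  decreasing eigenvalues \<open>\<lambda>\<close> and the increasing eigenvalues \<open>\<mu>\<close>. Comparing the squared eigenvalues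
  of \<open>S\<^sub>0 + S\<^sub>1\<close>, which by hypothesis sum to \<open>\<Sum>\<^sub>i (\<lambda>\<^sub>i + \<mu>\<^sub>i)\<^sup>2\<close>, with \<open>\<Sum>\<^sub>i \<parallel>(S\<^sub>0 + S\<^sub>1) u\<^sub>i\<parallel>\<^sup>2\<close> leaves
  an equality for the mixed term:
  \<open>\<Sum>\<^sub>i\<^sub>j \<lambda>\<^sub>i \<mu>\<^sub>j D\<^sub>i\<^sub>j = \<Sum>\<^sub>i \<lambda>\<^sub>i \<mu>\<^sub>i\<close> with \<open>D\<^sub>i\<^sub>j = |\<langle>u\<^sub>i, w\<^sub>j\<rangle>|\<^sup>2\<close> (\<open>overlap_sum_if_spectra_add\<close>).

  The matrix \<open>D\<close> is doubly stochastic, and among doubly stochastic matrices the identity minimises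
  the left hand side, because \<open>\<lambda>\<close> and \<open>\<mu>\<close> are oppositely ordered. So \<open>D\<close> is a minimiser too, and
  complementary slackness in the assignment problem shows that, between two pairs \<open>(i, j)\<close> in the
  support of \<open>D\<close>, the one with the larger \<open>\<lambda>\<^sub>i\<close> never has the larger \<open>\<mu>\<^sub>j\<close> (\<open>extremal_weights_support\<close>).

  This makes the two eigenbases agree after finitely many corrections (\<open>common_eigenbasis\<close>). If
  \<open>u\<^sub>i = w\<^sub>i\<close> for all \<open>i < k\<close>, the support condition says that \<open>u\<^sub>k\<close> is also an eigenvector of \<open>S\<^sub>1\<close>
  for \<open>\<mu>\<^sub>k\<close>, or \<open>w\<^sub>k\<close> is also an eigenvector of \<open>S\<^sub>0\<close> for \<open>\<lambda>\<^sub>k\<close>. In either case a unitary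
  reflection inside one eigenspace changes one of the bases so that they agree at \<open>k\<close> as well
  (\<open>eigenbasis_replace\<close>). The same reflections, applied to arbitrary orthonormal bases, also build
  the eigenbases in the first place (\<open>spectral_theorem\<close>).
\<close>

section \<open>Inner products and orthonormal families\<close>

lemma cscalar_prod_sum:
  fixes x y :: "complex vec"
  assumes "x \<in> carrier_vec d" "y \<in> carrier_vec d"
  shows "x \<bullet>c y = (\<Sum>a<d. x $ a * cnj (y $ a))"
  using assms by (auto simp: scalar_prod_def lessThan_atLeast0 intro!: sum.cong)

lemma cscalar_prod_commute:
  fixes x y :: "complex vec"
  assumes "x \<in> carrier_vec d" "y \<in> carrier_vec d"
  shows "y \<bullet>c x = cnj (x \<bullet>c y)"
  using assms by (simp add: cscalar_prod_sum mult.commute)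

lemma cscalar_prod_linear:
  fixes x y z :: "complex vec"
  assumes "x \<in> carrier_vec d" "y \<in> carrier_vec d" "z \<in> carrier_vec d"
  shows "(x + y) \<bullet>c z = x \<bullet>c z + y \<bullet>c z"
    and "(x - y) \<bullet>c z = x \<bullet>c z - y \<bullet>c z"
    and "(c \<cdot>\<^sub>v x) \<bullet>c z = c * (x \<bullet>c z)"
    and "z \<bullet>c (x + y) = z \<bullet>c x + z \<bullet>c y"
    and "z \<bullet>c (x - y) = z \<bullet>c x - z \<bullet>c y"
    and "z \<bullet>c (c \<cdot>\<^sub>v x) = cnj c * (z \<bullet>c x)"
  using assms
  by (simp_all add: cscalar_prod_sum[where d = d] algebra_simps sum.distrib sum_subtractf
      sum_distrib_left)

lemma cscalar_prod_self:
  fixes x :: "complex vec"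
  assumes "x \<in> carrier_vec d"
  shows "x \<bullet>c x = complex_of_real (\<Sum>a<d. (cmod (x $ a))\<^sup>2)"
  using assms
  by (simp only: cscalar_prod_sum of_real_sum) (simp add: complex_norm_square[symmetric])

lemma cscalar_prod_self_eq_0:
  fixes x :: "complex vec"
  assumes "x \<in> carrier_vec d" "x \<bullet>c x = 0"
  shows "x = 0\<^sub>v d"
  using assms by simp

text \<open>An orthonormal basis without the algebraic spanning condition, which is automatic for \<open>d\<close>
  orthonormal vectors and is restored in \<open>orthonormal_family_basis\<close>.\<close>

definition orthonormal_family :: "nat \<Rightarrow> (nat \<Rightarrow> complex vec) \<Rightarrow> bool" where
  "orthonormal_family d u \<longleftrightarrow>
     (\<forall>i<d. u i \<in> carrier_vec d) \<and>
     (\<forall>i<d. \<forall>j<d. u i \<bullet>c u j = (if i = j then 1 else 0))"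

lemma orthonormal_family_carrier [simp]:
  "orthonormal_family d u \<Longrightarrow> i < d \<Longrightarrow> u i \<in> carrier_vec d"
  by (simp add: orthonormal_family_def)

lemma orthonormal_familyD:
  "orthonormal_family d u \<Longrightarrow> i < d \<Longrightarrow> j < d \<Longrightarrow> u i \<bullet>c u j = (if i = j then 1 else 0)"
  unfolding orthonormal_family_def by blast

text \<open>If \<open>M\<close> has the vectors as columns, orthonormality says that the adjoint of \<open>M\<close> is a left inverse.
  For a square matrix it is then a right inverse as well, which is the resolution of the identity.\<close>

lemma completeness:
  assumes u: "orthonormal_family d u" and ab: "a < d" "b < d"
  shows "(\<Sum>j<d. u j $ a * cnj (u j $ b)) = (if a = b then 1 else 0)"
proof -
  define M where "M = mat d d (\<lambda>(a, j). u j $ a)"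
  define N where "N = mat d d (\<lambda>(j, a). cnj (u j $ a))"
  have M: "M \<in> carrier_mat d d" and N: "N \<in> carrier_mat d d"
    by (auto simp: M_def N_def)
  have "N * M = 1\<^sub>m d"
  proof (rule eq_matI)
    fix i j assume "i < dim_row (1\<^sub>m d)" "j < dim_col (1\<^sub>m d)"
    then have ij: "i < d" "j < d" by auto
    then have "(N * M) $$ (i, j) = (\<Sum>a<d. u j $ a * cnj (u i $ a))"
      by (simp add: M_def N_def scalar_prod_def lessThan_atLeast0 mult.commute)
    also have "\<dots> = u j \<bullet>c u i"
      using u ij by (simp add: cscalar_prod_sum[where d = d])
    finally show "(N * M) $$ (i, j) = 1\<^sub>m d $$ (i, j)"
      using orthonormal_familyD[OF u] ij by auto
  qed (use M N in auto)
  then have "M * N = 1\<^sub>m d"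
    using mat_mult_left_right_inverse[OF N M] by simp
  then have "(M * N) $$ (a, b) = (if a = b then 1 else 0)"
    using ab by simp
  then show ?thesis
    using ab by (simp add: M_def N_def scalar_prod_def lessThan_atLeast0)
qed

lemma parseval:
  assumes u: "orthonormal_family d u" and x: "x \<in> carrier_vec d" and y: "y \<in> carrier_vec d"
  shows "x \<bullet>c y = (\<Sum>j<d. (x \<bullet>c u j) * (u j \<bullet>c y))"
proof -
  have "(\<Sum>j<d. (x \<bullet>c u j) * (u j \<bullet>c y)) =
      (\<Sum>j<d. \<Sum>a<d. \<Sum>b<d. x $ a * cnj (y $ b) * (u j $ b * cnj (u j $ a)))"
    using u x y by (simp add: cscalar_prod_sum[where d = d] sum_product algebra_simps)
  also have "\<dots> = (\<Sum>a<d. \<Sum>b<d. x $ a * cnj (y $ b) * (\<Sum>j<d. u j $ b * cnj (u j $ a)))"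
    unfolding sum_distrib_left
    by (subst sum.swap, rule sum.cong[OF refl], rule sum.swap)
  also have "\<dots> = (\<Sum>a<d. \<Sum>b<d. x $ a * cnj (y $ b) * (if b = a then 1 else 0))"
    by (intro sum.cong refl) (simp add: completeness[OF u])
  also have "\<dots> = (\<Sum>a<d. x $ a * cnj (y $ a))"
    by (intro sum.cong refl) (simp add: if_distrib[of "\<lambda>t. _ * t"] cong: if_cong)
  finally show ?thesis
    using x y by (simp add: cscalar_prod_sum)
qed

lemma eq_if_same_coefficients:
  assumes u: "orthonormal_family d u" and x: "x \<in> carrier_vec d" and y: "y \<in> carrier_vec d"
    and eq: "\<And>j. j < d \<Longrightarrow> x \<bullet>c u j = y \<bullet>c u j"
  shows "x = y"
proof -
  have xy: "x - y \<in> carrier_vec d"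
    using x y by simp
  have "(x - y) \<bullet>c (x - y) = 0"
    unfolding parseval[OF u xy xy]
    using u x y eq by (auto simp: cscalar_prod_linear[where d = d] intro!: sum.neutral)
  then have "x - y = 0\<^sub>v d"
    using cscalar_prod_self_eq_0[OF xy] by simp
  then have "(x - y) $ a = 0" if "a < d" for a
    using that by simp
  then show ?thesis
    using x y by (intro eq_vecI) auto
qed

lemma orthonormal_family_basis:
  assumes u: "orthonormal_family d u"
  shows "orthonormal_basis d u"
proof -
  interpret vec_space "TYPE(complex)" d .
  have inj: "inj_on u {..<d}"
    by (rule inj_onI) (metis lessThan_iff orthonormal_familyD[OF u] zero_neq_one)
  have sub: "u ` {..<d} \<subseteq> carrier_vec d"
    using u by auto
  have "lin_indpt (u ` {..<d})"
  proof (rule finite_lin_indpt2)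
    fix a :: "complex vec \<Rightarrow> complex"
    assume 0: "lincomb a (u ` {..<d}) = 0\<^sub>v d"
    show "\<forall>v\<in>u ` {..<d}. a v = 0"
    proof (intro ballI, elim imageE)
      fix v i assume i: "i \<in> {..<d}" and v: "v = u i"
      have ui: "u i \<in> carrier_vec d" using u i by simp
      have "0 = lincomb a (u ` {..<d}) \<bullet>c u i"
        using 0 ui by simp
      also have "\<dots> = (\<Sum>v\<in>u ` {..<d}. (a v \<cdot>\<^sub>v v) \<bullet>c u i)"
        unfolding lincomb_def using sub ui by (subst finsum_scalar_prod_sum) auto
      also have "\<dots> = (\<Sum>j<d. a (u j) * (u j \<bullet>c u i))"
        using u ui by (simp add: sum.reindex[OF inj] cscalar_prod_linear[where d = d])
      also have "\<dots> = a (u i)"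
        using i by (simp add: orthonormal_familyD[OF u] if_distrib[of "\<lambda>t. _ * t"] cong: if_cong)
      finally show "a v = 0" by (simp add: v)
    qed
  qed (use sub in auto)
  then have "basis (u ` {..<d})"
    using sub by (intro dim_li_is_basis) (auto simp: card_image[OF inj] dim_is_n)
  then show ?thesis
    using u unfolding orthonormal_basis_def orthonormal_family_def by blast
qed

text \<open>Any unit vector can be made the \<open>k\<close>-th vector of an orthonormal basis by a complex Householder
  reflection \<open>z \<mapsto> z - \<langle>z, y\<rangle> y / t\<close> with \<open>y = u k - x\<close> and \<open>t = \<langle>u k, y\<rangle>\<close>. It sends \<open>u k\<close> to
  \<open>x\<close>, and it is unitary because \<open>\<langle>y, y\<rangle> = t + cnj t\<close>; the possibly non-real denominator is what
  spares a phase adjustment of \<open>x\<close>. The reflection fixes everything orthogonal to \<open>y\<close>, in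
  particular the other basis vectors orthogonal to \<open>x\<close>.\<close>

lemma orthonormal_replace:
  assumes u: "orthonormal_family d u" and k: "k < d"
    and x: "x \<in> carrier_vec d" "x \<bullet>c x = 1"
  obtains c u' where "orthonormal_family d u'" "u' k = x"
    "\<And>j. u' j = u j - (c * (u j \<bullet>c (u k - x))) \<cdot>\<^sub>v (u k - x)"
    "\<And>j. j < d \<Longrightarrow> u j \<bullet>c (u k - x) = 0 \<Longrightarrow> u' j = u j"
    "\<And>j. j < d \<Longrightarrow> j \<noteq> k \<Longrightarrow> x \<bullet>c u j = 0 \<Longrightarrow> u' j = u j"
proof -
  define y where "y = u k - x"
  define t where "t = u k \<bullet>c y"
  \<comment> \<open>If \<open>t = 0\<close> then \<open>y = 0\<close>, and with \<open>inverse 0 = 0\<close> the formula below is the identity map.\<close>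
  define u' where "u' j = u j - (inverse t * (u j \<bullet>c y)) \<cdot>\<^sub>v y" for j
  have uk: "u k \<in> carrier_vec d" "u k \<bullet>c u k = 1"
    using u k orthonormal_familyD[OF u k k] by auto
  have y: "y \<in> carrier_vec d"
    using uk x by (simp add: y_def)
  have xu: "x \<bullet>c u k = cnj (u k \<bullet>c x)"
    by (rule cscalar_prod_commute[OF uk(1) x(1)])
  have yy: "y \<bullet>c y = t + cnj t"
    using uk x xu by (simp add: y_def t_def cscalar_prod_linear[where d = d])
  have y0: "y = 0\<^sub>v d" if "t = 0"
    using cscalar_prod_self_eq_0[OF y] yy that by simp
  have "u' i \<bullet>c u' j = u i \<bullet>c u j" if ij: "i < d" "j < d" for i j
  proof (cases "t = 0")
    case True
    then have "u' l = u l" if "l < d" for l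
      using orthonormal_family_carrier[OF u that] y0 True by (intro eq_vecI) (auto simp: u'_def)
    then show ?thesis using ij by simp
  next
    case False
    have c: "u i \<in> carrier_vec d" "u j \<in> carrier_vec d"
      using u ij by auto
    define p where "p = u i \<bullet>c y"
    define q where "q = y \<bullet>c u j"
    have q: "u j \<bullet>c y = cnj q"
      unfolding q_def by (rule cscalar_prod_commute[OF y c(2)])
    have "u' i \<bullet>c u' j = u i \<bullet>c u j - cnj (inverse t) * q * p - inverse t * p * q
        + inverse t * p * (cnj (inverse t) * q) * (y \<bullet>c y)"
      using c y by (simp add: u'_def cscalar_prod_linear[where d = d] p_def[symmetric] q
          q_def[symmetric] algebra_simps)
    also have "\<dots> = u i \<bullet>c u j"
      unfolding yy using False by (simp add: field_simps)
    finally show ?thesis .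
  qed
  moreover have "u' i \<in> carrier_vec d" if "i < d" for i
    using u y that by (simp add: u'_def)
  ultimately have "orthonormal_family d u'"
    using orthonormal_familyD[OF u] unfolding orthonormal_family_def by metis
  moreover have "u' k = x"
  proof (cases "t = 0")
    case True
    then have "u k - x = 0\<^sub>v d" using y0 by (simp add: y_def)
    then have "(u k - x) $ a = 0" if "a < d" for a using that by simp
    then show ?thesis
      using True uk x y by (intro eq_vecI) (auto simp: u'_def)
  next
    case False
    then have "u' k = u k - 1 \<cdot>\<^sub>v y"
      unfolding u'_def t_def[symmetric] by simp
    then show ?thesis
      using uk x by (intro eq_vecI) (auto simp: y_def)
  qed
  moreover have fix_if: "u' j = u j" if j: "j < d" "u j \<bullet>c y = 0" for j
  proof -
    have "u' j = u j - 0 \<cdot>\<^sub>v y" by (simp add: u'_def j(2))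
    then show ?thesis
      using orthonormal_family_carrier[OF u j(1)] y by (intro eq_vecI) auto
  qed
  moreover have "u' j = u j" if j: "j < d" "j \<noteq> k" "x \<bullet>c u j = 0" for j
  proof (rule fix_if[OF j(1)])
    have uj: "u j \<in> carrier_vec d" using u j by simp
    have "u j \<bullet>c x = 0"
      using cscalar_prod_commute[OF x(1) uj] j(3) by simp
    then show "u j \<bullet>c y = 0"
      using orthonormal_familyD[OF u j(1) k] j(2) uj uk x
      by (simp add: y_def cscalar_prod_linear[where d = d])
  qed
  ultimately show thesis
    using that[of u' "inverse t"] by (simp add: u'_def y_def)
qed

section \<open>Self-adjoint matrices\<close>

lemma mat_adjoint_index:
  fixes S :: "complex mat"
  assumes "S \<in> carrier_mat d d" "i < d" "j < d"
  shows "mat_adjoint S $$ (i, j) = cnj (S $$ (j, i))"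
  using assms by (simp add: mat_adjoint_def mat_of_rows_index)

lemma self_adjoint_index:
  assumes "self_adjoint d S" "i < d" "j < d"
  shows "S $$ (i, j) = cnj (S $$ (j, i))"
  using assms mat_adjoint_index[of S d i j] by (auto simp: self_adjoint_def)

lemma self_adjoint_carrier: "self_adjoint d S \<Longrightarrow> S \<in> carrier_mat d d"
  by (simp add: self_adjoint_def)

lemma self_adjoint_mult_vec [simp]:
  "self_adjoint d S \<Longrightarrow> x \<in> carrier_vec d \<Longrightarrow> S *\<^sub>v x \<in> carrier_vec d"
  by (auto simp: self_adjoint_def)

lemma mult_mat_vec_index_sum:
  "S \<in> carrier_mat d d \<Longrightarrow> x \<in> carrier_vec d \<Longrightarrow> a < d \<Longrightarrow>
    (S *\<^sub>v x) $ a = (\<Sum>b<d. S $$ (a, b) * x $ b)"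
  by (auto simp: scalar_prod_def lessThan_atLeast0 intro!: sum.cong)

lemma self_adjoint_cscalar_prod:
  assumes S: "self_adjoint d S" and x: "x \<in> carrier_vec d" and y: "y \<in> carrier_vec d"
  shows "(S *\<^sub>v x) \<bullet>c y = x \<bullet>c (S *\<^sub>v y)"
proof -
  note C = self_adjoint_carrier[OF S]
  have "(S *\<^sub>v x) \<bullet>c y = (\<Sum>a<d. \<Sum>b<d. S $$ (a, b) * x $ b * cnj (y $ a))"
    using S x y
    by (simp add: cscalar_prod_sum[where d = d] mult_mat_vec_index_sum[OF C] sum_distrib_right
        del: index_mult_mat_vec)
  also have "\<dots> = (\<Sum>a<d. \<Sum>b<d. cnj (S $$ (b, a)) * x $ b * cnj (y $ a))"
    by (intro sum.cong refl) (metis lessThan_iff self_adjoint_index[OF S])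
  also have "\<dots> = (\<Sum>b<d. \<Sum>a<d. cnj (S $$ (b, a)) * x $ b * cnj (y $ a))"
    by (rule sum.swap)
  also have "\<dots> = x \<bullet>c (S *\<^sub>v y)"
    using S x y
    by (simp add: cscalar_prod_sum[where d = d] mult_mat_vec_index_sum[OF C] sum_distrib_left
        mult.assoc mult.left_commute del: index_mult_mat_vec)
  finally show ?thesis .
qed

lemma self_adjoint_add:
  assumes "self_adjoint d A" "self_adjoint d B"
  shows "self_adjoint d (A + B)"
proof -
  have A: "A \<in> carrier_mat d d" and B: "B \<in> carrier_mat d d"
    using assms by (auto dest: self_adjoint_carrier)
  have "mat_adjoint (A + B) = A + B"
  proof (rule eq_matI)
    fix i j assume "i < dim_row (A + B)" "j < dim_col (A + B)"
    then have ij: "i < d" "j < d" using A B by auto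
    show "mat_adjoint (A + B) $$ (i, j) = (A + B) $$ (i, j)"
      using A B ij self_adjoint_index[OF assms(1) ij] self_adjoint_index[OF assms(2) ij]
      by (simp add: mat_adjoint_index[of _ d])
  qed (use A B in \<open>auto simp: mat_adjoint_def\<close>)
  then show ?thesis using A B by (simp add: self_adjoint_def)
qed

definition eigenbasis :: "nat \<Rightarrow> complex mat \<Rightarrow> (nat \<Rightarrow> real) \<Rightarrow> (nat \<Rightarrow> complex vec) \<Rightarrow> bool" where
  "eigenbasis d S e u \<longleftrightarrow>
     orthonormal_family d u \<and> (\<forall>i<d. S *\<^sub>v u i = complex_of_real (e i) \<cdot>\<^sub>v u i)"

lemma eigenbasisD:
  assumes "eigenbasis d S e u"
  shows "orthonormal_family d u"
    and "i < d \<Longrightarrow> S *\<^sub>v u i = complex_of_real (e i) \<cdot>\<^sub>v u i"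
  using assms by (auto simp: eigenbasis_def)

lemma eigenvalue_coefficient:
  assumes S: "self_adjoint d S" and b: "eigenbasis d S e u"
    and x: "x \<in> carrier_vec d" and j: "j < d"
  shows "(S *\<^sub>v x) \<bullet>c u j = complex_of_real (e j) * (x \<bullet>c u j)"
  using S x j eigenbasisD[OF b]
  by (simp add: self_adjoint_cscalar_prod cscalar_prod_linear[where d = d])

text \<open>An eigenspace is spanned by the basis vectors with that eigenvalue, so membership can be read off
  from the nonzero coefficients.\<close>

lemma eigenvector_if_support:
  assumes S: "self_adjoint d S" and b: "eigenbasis d S e u" and x: "x \<in> carrier_vec d"
    and supp: "\<And>j. j < d \<Longrightarrow> x \<bullet>c u j \<noteq> 0 \<Longrightarrow> e j = r"
  shows "S *\<^sub>v x = complex_of_real r \<cdot>\<^sub>v x"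
proof (rule eq_if_same_coefficients[OF eigenbasisD(1)[OF b]])
  fix j assume j: "j < d"
  show "(S *\<^sub>v x) \<bullet>c u j = (complex_of_real r \<cdot>\<^sub>v x) \<bullet>c u j"
    using supp[OF j] x j eigenbasisD(1)[OF b]
    by (cases "x \<bullet>c u j = 0")
      (auto simp: eigenvalue_coefficient[OF S b x j] cscalar_prod_linear[where d = d])
qed (use S x in auto)

lemma eigenvectors_orthogonal:
  assumes S: "self_adjoint d S" and x: "x \<in> carrier_vec d" and y: "y \<in> carrier_vec d"
    and "S *\<^sub>v x = complex_of_real r \<cdot>\<^sub>v x" "S *\<^sub>v y = complex_of_real s \<cdot>\<^sub>v y" "r \<noteq> s"
  shows "x \<bullet>c y = 0"
proof -
  have "complex_of_real r * (x \<bullet>c y) = complex_of_real s * (x \<bullet>c y)"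
    using self_adjoint_cscalar_prod[OF S x y] assms by (simp add: cscalar_prod_linear[where d = d])
  then show ?thesis using \<open>r \<noteq> s\<close> by simp
qed

section \<open>The spectral theorem, with eigenvalues in a prescribed order\<close>

lemma scale_to_unit:
  fixes x :: "complex vec"
  assumes x: "x \<in> carrier_vec d" "x \<noteq> 0\<^sub>v d"
  obtains c where "(c \<cdot>\<^sub>v x) \<bullet>c (c \<cdot>\<^sub>v x) = 1"
proof -
  define s where "s = (\<Sum>a<d. (cmod (x $ a))\<^sup>2)"
  have xx: "x \<bullet>c x = complex_of_real s"
    using cscalar_prod_self[OF x(1)] by (simp add: s_def)
  have "s \<ge> 0"
    by (simp add: s_def sum_nonneg)
  moreover have "s \<noteq> 0"
    using xx cscalar_prod_self_eq_0[OF x(1)] x(2) by auto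
  ultimately have s: "s > 0" by simp
  define c where "c = complex_of_real (1 / sqrt s)"
  have "(c \<cdot>\<^sub>v x) \<bullet>c (c \<cdot>\<^sub>v x) = c * cnj c * (x \<bullet>c x)"
    using x by (simp add: cscalar_prod_linear[where d = d])
  also have "\<dots> = complex_of_real (1 / sqrt s * (1 / sqrt s) * s)"
    by (simp only: c_def xx complex_cnj_complex_of_real of_real_mult)
  also have "1 / sqrt s * (1 / sqrt s) * s = 1"
    using s by (simp add: field_simps)
  finally show thesis using that by simp
qed

lemma real_eigenvalue:
  assumes S: "self_adjoint d S" and x: "x \<in> carrier_vec d" "x \<bullet>c x = 1"
    and e: "S *\<^sub>v x = r \<cdot>\<^sub>v x"
  shows "r = complex_of_real (Re r)"
proof -
  have "r * (x \<bullet>c x) = cnj r * (x \<bullet>c x)"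
    using self_adjoint_cscalar_prod[OF S x(1) x(1)] x
    by (simp add: e cscalar_prod_linear[where d = d])
  then have "r = cnj r" using x by simp
  then show ?thesis by (metis Reals_cnj_iff of_real_Re)
qed

text \<open>The span of \<open>u k, \<dots>, u (d - 1)\<close> is invariant under \<open>S\<close>, being the orthogonal complement of
  eigenvectors of a self-adjoint matrix. An eigenvector of the compression \<open>M\<close> of \<open>S\<close> to this
  span, which exists over the complex numbers, is therefore an eigenvector of \<open>S\<close>.\<close>

lemma eigenvector_in_complement:
  assumes S: "self_adjoint d S" and u: "orthonormal_family d u" and k: "k < d"
    and e: "\<And>i. i < k \<Longrightarrow> S *\<^sub>v u i = complex_of_real (e i) \<cdot>\<^sub>v u i"
  obtains x r where "x \<in> carrier_vec d" "x \<bullet>c x = 1" "S *\<^sub>v x = complex_of_real r \<cdot>\<^sub>v x"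
    "\<And>i. i < k \<Longrightarrow> x \<bullet>c u i = 0"
proof -
  define M where "M = mat (d - k) (d - k) (\<lambda>(i, j). (S *\<^sub>v u (k + j)) \<bullet>c u (k + i))"
  have M: "M \<in> carrier_mat (d - k) (d - k)"
    by (simp add: M_def)
  have "spectrum M \<noteq> {}"
    using k by (intro spectrum_non_empty[OF M]) simp
  then obtain r c where c: "c \<in> carrier_vec (d - k)" "c \<noteq> 0\<^sub>v (d - k)" "M *\<^sub>v c = r \<cdot>\<^sub>v c"
    using M by (auto simp: spectrum_def eigenvalue_def eigenvector_def)
  define y where "y = vec d (\<lambda>a. \<Sum>j<d-k. c $ j * u (k + j) $ a)"
  have y: "y \<in> carrier_vec d" by (simp add: y_def)
  have y_prod: "y \<bullet>c z = (\<Sum>j<d-k. c $ j * (u (k + j) \<bullet>c z))" if z: "z \<in> carrier_vec d" for z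
  proof -
    have "y \<bullet>c z = (\<Sum>a<d. \<Sum>j<d-k. c $ j * u (k + j) $ a * cnj (z $ a))"
      using cscalar_prod_sum[OF y z] by (simp add: y_def sum_distrib_right)
    also have "\<dots> = (\<Sum>j<d-k. \<Sum>a<d. c $ j * u (k + j) $ a * cnj (z $ a))"
      by (rule sum.swap)
    also have "\<dots> = (\<Sum>j<d-k. c $ j * (u (k + j) \<bullet>c z))"
    proof (intro sum.cong refl)
      fix j assume "j \<in> {..<d-k}"
      then have "u (k + j) \<in> carrier_vec d" using u by simp
      then show "(\<Sum>a<d. c $ j * u (k + j) $ a * cnj (z $ a)) = c $ j * (u (k + j) \<bullet>c z)"
        using z by (simp add: cscalar_prod_sum[where d = d] sum_distrib_left mult.assoc)
    qed
    finally show ?thesis .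
  qed
  have low: "y \<bullet>c u i = 0" if i: "i < k" for i
  proof -
    have "u (k + j) \<bullet>c u i = 0" if "j < d - k" for j
      using orthonormal_familyD[OF u, of "k + j" i] that i k by simp
    then show ?thesis
      using y_prod[of "u i"] u i k by simp
  qed
  have high: "y \<bullet>c u (k + i) = c $ i" if i: "i < d - k" for i
  proof -
    have "u (k + j) \<bullet>c u (k + i) = (if i = j then 1 else 0)" if "j < d - k" for j
      using orthonormal_familyD[OF u, of "k + j" "k + i"] that i k by auto
    then have "y \<bullet>c u (k + i) = (\<Sum>j<d-k. c $ j * (if i = j then 1 else 0))"
      using y_prod[of "u (k + i)"] u i k by simp
    also have "\<dots> = c $ i"
      using i by (simp add: if_distrib[of "\<lambda>t. _ * t"] cong: if_cong)
    finally show ?thesis .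
  qed
  have y_eigen: "S *\<^sub>v y = r \<cdot>\<^sub>v y"
  proof (rule eq_if_same_coefficients[OF u])
    fix l assume l: "l < d"
    then have ul: "u l \<in> carrier_vec d" using u by simp
    show "(S *\<^sub>v y) \<bullet>c u l = (r \<cdot>\<^sub>v y) \<bullet>c u l"
    proof (cases "l < k")
      case True
      have "(S *\<^sub>v y) \<bullet>c u l = complex_of_real (e l) * (y \<bullet>c u l)"
        using self_adjoint_cscalar_prod[OF S y ul] y ul e[OF True]
        by (simp add: cscalar_prod_linear[where d = d])
      then show ?thesis
        using low[OF True] y ul by (simp add: cscalar_prod_linear[where d = d])
    next
      case False
      then obtain i where i: "l = k + i" "i < d - k"
        using l by (metis add_diff_inverse_nat diff_less_mono not_less)
      have "(S *\<^sub>v y) \<bullet>c u l = y \<bullet>c (S *\<^sub>v u l)"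
        by (rule self_adjoint_cscalar_prod[OF S y ul])
      also have "\<dots> = (\<Sum>j<d-k. c $ j * (u (k + j) \<bullet>c (S *\<^sub>v u l)))"
        using y_prod S ul by simp
      also have "\<dots> = (\<Sum>j<d-k. M $$ (i, j) * c $ j)"
      proof (intro sum.cong refl)
        fix j assume "j \<in> {..<d-k}"
        then have j: "j < d - k" "u (k + j) \<in> carrier_vec d" using u by auto
        show "c $ j * (u (k + j) \<bullet>c (S *\<^sub>v u l)) = M $$ (i, j) * c $ j"
          using j i self_adjoint_cscalar_prod[OF S j(2) ul] by (simp add: M_def)
      qed
      also have "\<dots> = (M *\<^sub>v c) $ i"
        using mult_mat_vec_index_sum[OF M c(1) i(2)] by simp
      also have "\<dots> = r * (y \<bullet>c u l)"
        using c i high[OF i(2)] by simp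
      finally show ?thesis
        using y ul by (simp add: cscalar_prod_linear[where d = d])
    qed
  qed (use S y in auto)
  have "y \<noteq> 0\<^sub>v d"
  proof
    assume 0: "y = 0\<^sub>v d"
    have "c $ i = 0" if i: "i < d - k" for i
    proof -
      have "u (k + i) \<in> carrier_vec d" using u i by simp
      then show ?thesis using high[OF i] 0 by simp
    qed
    then have "c = 0\<^sub>v (d - k)" using c(1) by (intro eq_vecI) auto
    then show False using c(2) by simp
  qed
  then obtain b where b: "(b \<cdot>\<^sub>v y) \<bullet>c (b \<cdot>\<^sub>v y) = 1"
    using scale_to_unit[OF y] by blast
  define x where "x = b \<cdot>\<^sub>v y"
  have x: "x \<in> carrier_vec d" "x \<bullet>c x = 1" using y b by (auto simp: x_def)
  have Sx: "S *\<^sub>v x = r \<cdot>\<^sub>v x"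
    using y_eigen mult_mat_vec[OF self_adjoint_carrier[OF S] y, of b]
    by (simp add: x_def smult_smult_assoc mult.commute)
  show thesis
  proof
    show "S *\<^sub>v x = complex_of_real (Re r) \<cdot>\<^sub>v x"
      using Sx real_eigenvalue[OF S x Sx] by simp
    show "x \<bullet>c u i = 0" if "i < k" for i
    proof -
      have "u i \<in> carrier_vec d" using u that k by simp
      then show ?thesis
        using low[OF that] y by (simp add: x_def cscalar_prod_linear[where d = d])
    qed
  qed (fact x)+
qed

text \<open>The orthonormal basis is turned into an eigenbasis one vector at a time: the next eigenvector is
  found in the complement of the previous ones, and reflecting it into place leaves those alone.\<close>

lemma spectral_theorem:
  assumes S: "self_adjoint d S"
  obtains e u where "eigenbasis d S e u"
proof -
  have "\<exists>e u. orthonormal_family d u \<and> (\<forall>i<k. S *\<^sub>v u i = complex_of_real (e i) \<cdot>\<^sub>v u i)"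
    if "k \<le> d" for k
    using that
  proof (induction k)
    case 0
    have "orthonormal_family d (unit_vec d)"
      by (auto simp: orthonormal_family_def cscalar_prod_sum[where d = d]
          if_distrib[of cnj] if_distrib[of "\<lambda>t. t * _"] cong: if_cong)
    then show ?case by auto
  next
    case (Suc k)
    then obtain e u where u: "orthonormal_family d u"
      and e: "\<And>i. i < k \<Longrightarrow> S *\<^sub>v u i = complex_of_real (e i) \<cdot>\<^sub>v u i"
      by auto
    have k: "k < d" using Suc by simp
    obtain x r where x: "x \<in> carrier_vec d" "x \<bullet>c x = 1"
      and r: "S *\<^sub>v x = complex_of_real r \<cdot>\<^sub>v x"
      and low: "\<And>i. i < k \<Longrightarrow> x \<bullet>c u i = 0"
      using eigenvector_in_complement[OF S u k e] by metis
    obtain u' where u': "orthonormal_family d u'" "u' k = x"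
      and keep: "\<And>j. j < d \<Longrightarrow> j \<noteq> k \<Longrightarrow> x \<bullet>c u j = 0 \<Longrightarrow> u' j = u j"
      using orthonormal_replace[OF u k x] by metis
    have "u' i = u i" if i: "i < k" for i
      using keep[of i] low[OF i] i k by simp
    then have "S *\<^sub>v u' i = complex_of_real ((e(k := r)) i) \<cdot>\<^sub>v u' i" if "i < Suc k" for i
      using that e r u'(2) by (cases "i = k") auto
    then show ?case using u'(1) by blast
  qed
  then obtain e u where "orthonormal_family d u"
    and "\<forall>i<d. S *\<^sub>v u i = complex_of_real (e i) \<cdot>\<^sub>v u i"
    by blast
  then show thesis using that by (simp add: eigenbasis_def)
qed

text \<open>When \<open>x\<close> lies in the eigenspace of \<open>u k\<close>, so does \<open>y = u k - x\<close>. The reflection along \<open>y\<close> only moves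
  basis vectors that are not orthogonal to \<open>y\<close>; these belong to the same eigenspace, because
  different eigenspaces are orthogonal, and they stay in it.\<close>

lemma eigenbasis_replace:
  assumes S: "self_adjoint d S" and b: "eigenbasis d S e u" and k: "k < d"
    and x: "x \<in> carrier_vec d" "x \<bullet>c x = 1" and Sx: "S *\<^sub>v x = complex_of_real (e k) \<cdot>\<^sub>v x"
  obtains u' where "eigenbasis d S e u'" "u' k = x"
    "\<And>j. j < d \<Longrightarrow> j \<noteq> k \<Longrightarrow> x \<bullet>c u j = 0 \<Longrightarrow> u' j = u j"
proof -
  note u = eigenbasisD(1)[OF b]
  define y where "y = u k - x"
  have uk: "u k \<in> carrier_vec d" using u k by simp
  have y: "y \<in> carrier_vec d" using uk x by (simp add: y_def)
  note C = self_adjoint_carrier[OF S]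
  have Sy: "S *\<^sub>v y = complex_of_real (e k) \<cdot>\<^sub>v y"
    unfolding y_def mult_minus_distrib_mat_vec[OF C uk x(1)] eigenbasisD(2)[OF b k] Sx
    using uk x(1) by (intro eq_vecI) (auto simp: algebra_simps)
  obtain c u' where u': "orthonormal_family d u'" "u' k = x"
    and u'_def: "\<And>j. u' j = u j - (c * (u j \<bullet>c y)) \<cdot>\<^sub>v y"
    and keep0: "\<And>j. j < d \<Longrightarrow> u j \<bullet>c y = 0 \<Longrightarrow> u' j = u j"
    and keep: "\<And>j. j < d \<Longrightarrow> j \<noteq> k \<Longrightarrow> x \<bullet>c u j = 0 \<Longrightarrow> u' j = u j"
    using orthonormal_replace[OF u k x] unfolding y_def by metis
  have "S *\<^sub>v u' j = complex_of_real (e j) \<cdot>\<^sub>v u' j" if j: "j < d" for j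
  proof (cases "u j \<bullet>c y = 0")
    case True
    then show ?thesis using keep0[OF j] eigenbasisD(2)[OF b j] by simp
  next
    case False
    have uj: "u j \<in> carrier_vec d" using u j by simp
    have ej: "e k = e j"
      using eigenvectors_orthogonal[OF S uj y eigenbasisD(2)[OF b j] Sy] False by metis
    define r where "r = c * (u j \<bullet>c y)"
    have "S *\<^sub>v u' j = S *\<^sub>v u j - r \<cdot>\<^sub>v (S *\<^sub>v y)"
      using mult_minus_distrib_mat_vec[OF C uj] mult_mat_vec[OF C y, of r] y
      by (simp add: u'_def r_def)
    also have "\<dots> = complex_of_real (e j) \<cdot>\<^sub>v (u j - r \<cdot>\<^sub>v y)"
      using uj y unfolding eigenbasisD(2)[OF b j] Sy ej
      by (intro eq_vecI) (auto simp: algebra_simps)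
    finally show ?thesis by (simp add: u'_def r_def)
  qed
  then have "eigenbasis d S e u'"
    using u'(1) by (simp add: eigenbasis_def)
  then show thesis
    using that u'(2) keep by metis
qed

text \<open>Diagonalising \<open>S\<close> with the unitary matrix of the eigenbasis identifies the diagonal entries with
  the roots of the characteristic polynomial, including multiplicities.\<close>

lemma eigenvalues_eigenbasis:
  assumes S: "self_adjoint d S" and b: "eigenbasis d S e u"
  shows "mset (eigvals_incr S) = mset (map e [0..<d])"
proof -
  note u = eigenbasisD(1)[OF b] and C = self_adjoint_carrier[OF S]
  define D where "D = mat d d (\<lambda>(i, j). if i = j then complex_of_real (e i) else 0)"
  define P where "P = mat d d (\<lambda>(a, j). u j $ a)"
  define Q where "Q = mat d d (\<lambda>(j, a). cnj (u j $ a))"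
  have D: "D \<in> carrier_mat d d" and P: "P \<in> carrier_mat d d" and Q: "Q \<in> carrier_mat d d"
    by (auto simp: D_def P_def Q_def)
  have PQ: "P * Q = 1\<^sub>m d"
    by (rule eq_matI)
      (auto simp: P_def Q_def scalar_prod_def lessThan_atLeast0[symmetric] completeness[OF u])
  have QP: "Q * P = 1\<^sub>m d"
    by (rule mat_mult_left_right_inverse[OF P Q PQ])
  have "S * P = P * D"
  proof (rule eq_matI)
    fix a j assume "a < dim_row (P * D)" "j < dim_col (P * D)"
    then have aj: "a < d" "j < d" using P D by auto
    then have uj: "u j \<in> carrier_vec d" using u by simp
    have "col P j = u j" using uj aj by (intro eq_vecI) (auto simp: P_def)
    then have "(S * P) $$ (a, j) = (S *\<^sub>v u j) $ a"
      using C P aj by simp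
    also have "\<dots> = complex_of_real (e j) * u j $ a"
      using eigenbasisD(2)[OF b aj(2)] uj aj by simp
    also have "\<dots> = (P * D) $$ (a, j)"
      using aj by (simp add: P_def D_def scalar_prod_def if_distrib[of "\<lambda>t. _ * t"] cong: if_cong)
    finally show "(S * P) $$ (a, j) = (P * D) $$ (a, j)" .
  qed (use C P D in auto)
  then have "S = P * D * Q"
    using assoc_mult_mat[OF C P Q] C by (simp add: PQ)
  then have "similar_mat S D"
    using C D P Q PQ QP by (intro similar_matI[of _ _ P Q d]) auto
  then have "char_poly S = char_poly D"
    by (rule char_poly_similar)
  also have "\<dots> = (\<Prod>a\<leftarrow>diag_mat D. [:- a, 1:])"
    by (rule char_poly_upper_triangular[OF D]) (auto simp: upper_triangular_def D_def)
  also have "diag_mat D = map (\<lambda>i. complex_of_real (e i)) [0..<d]"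
    by (auto simp: diag_mat_def D_def)
  finally have "char_poly S = (\<Prod>a\<leftarrow>map (\<lambda>i. complex_of_real (e i)) [0..<d]. [:- a, 1:])" .
  moreover have "proots (\<Prod>a\<leftarrow>as. [:- a, 1:]) = mset as" for as :: "complex list"
  proof (induction as)
    case (Cons a as)
    have "(\<Prod>a\<leftarrow>as. [:- a, 1:]) \<noteq> (0 :: complex poly)"
      by (auto simp: prod_list_zero_iff)
    then show ?case
      using Cons by (simp add: proots_mult del: mult_pCons_left)
  qed simp
  ultimately have "proots (char_poly S) = mset (map (\<lambda>i. complex_of_real (e i)) [0..<d])"
    by (simp only:)
  then show ?thesis
    by (simp add: eigvals_incr_def image_mset.compositionality comp_def)
qed

lemma spectral_theorem_ordered:
  assumes S: "self_adjoint d S" and es: "mset es = mset (eigvals_incr S)"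
  obtains u where "eigenbasis d S ((!) es) u"
proof -
  obtain e u where b: "eigenbasis d S e u"
    using spectral_theorem[OF S] by blast
  have "mset es = mset (map e [0..<d])"
    using es eigenvalues_eigenbasis[OF S b] by simp
  then obtain p where p: "p permutes {..<d}" and perm: "permute_list p (map e [0..<d]) = es"
    using mset_eq_permutation[of es "map e [0..<d]"] by auto
  have pd: "p i < d" if "i < d" for i
    using permutes_in_image[OF p, of i] that by simp
  have es_nth: "es ! i = e (p i)" if "i < d" for i
    using permute_list_nth[of p "map e [0..<d]" i] p perm pd that by simp
  have "p i = p j \<longleftrightarrow> i = j" for i j
    using permutes_inj[OF p] by (auto dest: injD)
  then have "orthonormal_family d (u \<circ> p)"
    using orthonormal_familyD[OF eigenbasisD(1)[OF b]] eigenbasisD(1)[OF b] pd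
    unfolding orthonormal_family_def by simp
  then have "eigenbasis d S ((!) es) (u \<circ> p)"
    using eigenbasisD(2)[OF b] pd es_nth by (simp add: eigenbasis_def)
  then show thesis by (rule that)
qed

section \<open>Equality in the rearrangement inequality for doubly stochastic weights\<close>

text \<open>A dual solution of the assignment problem with costs \<open>lam i * mu j\<close>: the potentials
  \<open>lam i * mu i - g i\<close> for rows and \<open>g j\<close> for columns lie below the costs and meet them on the
  diagonal. The function \<open>g\<close> is the discrete integral of \<open>lam\<close> against \<open>mu\<close>; since \<open>lam\<close> decreases,
  replacing its values between \<open>i\<close> and \<open>j\<close> by \<open>lam i\<close> errs in the same direction for \<open>i \<le> j\<close>
  and for \<open>j \<le> i\<close>.\<close>

lemma rearrangement_slack:
  fixes lam mu :: "nat \<Rightarrow> real"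
  assumes lam: "\<And>i j. i \<le> j \<Longrightarrow> j < d \<Longrightarrow> lam j \<le> lam i"
    and mu: "\<And>i j. i \<le> j \<Longrightarrow> j < d \<Longrightarrow> mu i \<le> mu j"
  obtains g where "\<And>i j. i < d \<Longrightarrow> j < d \<Longrightarrow> g j - g i \<le> lam i * (mu j - mu i)"
proof -
  define g where "g j = (\<Sum>m<j. lam m * (mu (Suc m) - mu m))" for j
  have right: "g j - g i \<le> lam i * (mu j - mu i)" if "i \<le> j" "j < d" for i j
    using that
  proof (induction j rule: dec_induct)
    case (step m)
    have "lam m * (mu (Suc m) - mu m) \<le> lam i * (mu (Suc m) - mu m)"
      using step lam[of i m] mu[of m "Suc m"] by (intro mult_right_mono) auto
    then show ?case using step by (simp add: g_def algebra_simps)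
  qed simp
  have left: "lam i * (mu i - mu j) \<le> g i - g j" if "j \<le> i" "i < d" for i j
    using that(1)
  proof (induction j rule: inc_induct)
    case (step m)
    have "lam i * (mu (Suc m) - mu m) \<le> lam m * (mu (Suc m) - mu m)"
      using step that lam[of m i] mu[of m "Suc m"] by (intro mult_right_mono) auto
    then show ?case using step by (simp add: g_def algebra_simps)
  qed simp
  have "g j - g i \<le> lam i * (mu j - mu i)" if "i < d" "j < d" for i j
    using right[of i j] left[of j i] that by (cases "i \<le> j") (auto simp: algebra_simps)
  then show thesis by (rule that)
qed

text \<open>Complementary slackness. Weighting the slacks \<open>s\<close> of the dual solution by \<open>D\<close> gives the difference of
  the two sides of the assumed equality, namely \<open>0\<close>, so \<open>s\<close> vanishes on the support of \<open>D\<close>.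
  Exchanging the columns of two entries of the support cannot make the total slack negative, and
  the potentials cancel in this comparison.\<close>

lemma extremal_weights_support:
  fixes lam mu :: "nat \<Rightarrow> real" and D :: "nat \<Rightarrow> nat \<Rightarrow> real"
  assumes lam: "\<And>i j. i \<le> j \<Longrightarrow> j < d \<Longrightarrow> lam j \<le> lam i"
    and mu: "\<And>i j. i \<le> j \<Longrightarrow> j < d \<Longrightarrow> mu i \<le> mu j"
    and D: "\<And>i j. i < d \<Longrightarrow> j < d \<Longrightarrow> 0 \<le> D i j"
    and row: "\<And>i. i < d \<Longrightarrow> (\<Sum>j<d. D i j) = 1"
    and column: "\<And>j. j < d \<Longrightarrow> (\<Sum>i<d. D i j) = 1"
    and eq: "(\<Sum>i<d. \<Sum>j<d. lam i * mu j * D i j) = (\<Sum>i<d. lam i * mu i)"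
    and ij: "i < d" "j < d" "D i j \<noteq> 0" and kl: "k < d" "l < d" "D k l \<noteq> 0"
  shows "(lam i - lam k) * (mu j - mu l) \<le> 0"
proof -
  obtain g where g: "\<And>i j. i < d \<Longrightarrow> j < d \<Longrightarrow> g j - g i \<le> lam i * (mu j - mu i)"
    using rearrangement_slack[of d lam mu] lam mu by metis
  define s where "s i j = lam i * (mu j - mu i) - (g j - g i)" for i j
  have s: "0 \<le> s i j" if "i < d" "j < d" for i j
    using g[OF that] by (simp add: s_def)
  have f_sum: "(\<Sum>i<d. \<Sum>j<d. f i * D i j) = (\<Sum>i<d. f i)" for f
    using row by (simp flip: sum_distrib_left)
  have g_sum: "(\<Sum>i<d. \<Sum>j<d. g j * D i j) = (\<Sum>j<d. g j)"
    using column by (subst sum.swap) (simp flip: sum_distrib_left)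
  have "(\<Sum>i<d. \<Sum>j<d. s i j * D i j) =
      (\<Sum>i<d. \<Sum>j<d. lam i * mu j * D i j) - (\<Sum>i<d. \<Sum>j<d. (lam i * mu i) * D i j)
      - (\<Sum>i<d. \<Sum>j<d. g j * D i j) + (\<Sum>i<d. \<Sum>j<d. g i * D i j)"
    by (simp add: s_def algebra_simps sum.distrib sum_subtractf)
  also have "\<dots> = 0"
    unfolding eq g_sum f_sum[of "\<lambda>i. lam i * mu i"] f_sum[of g] by simp
  finally have 0: "(\<Sum>i<d. \<Sum>j<d. s i j * D i j) = 0" .
  have inner: "(\<Sum>j<d. s i j * D i j) = 0" if "i < d" for i
    using 0 that s D by (subst (asm) sum_nonneg_eq_0_iff) (auto intro!: sum_nonneg)
  have tight: "s i j = 0" if "i < d" "j < d" "D i j \<noteq> 0" for i j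
    using inner[OF that(1)] that s D by (subst (asm) sum_nonneg_eq_0_iff) auto
  have "s i j + s k l \<le> s i l + s k j"
    using tight ij kl s by simp
  then show ?thesis by (simp add: s_def algebra_simps)
qed

section \<open>Overlaps of two eigenbases\<close>

definition overlap :: "(nat \<Rightarrow> complex vec) \<Rightarrow> (nat \<Rightarrow> complex vec) \<Rightarrow> nat \<Rightarrow> nat \<Rightarrow> real" where
  "overlap u w i j = (cmod (u i \<bullet>c w j))\<^sup>2"

lemma overlap_complex:
  assumes "orthonormal_family d u" "orthonormal_family d w" "i < d" "j < d"
  shows "(u i \<bullet>c w j) * (w j \<bullet>c u i) = complex_of_real (overlap u w i j)"
proof -
  have "w j \<bullet>c u i = cnj (u i \<bullet>c w j)"
    by (rule cscalar_prod_commute[of _ d]) (use assms in auto)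
  then show ?thesis by (simp only: overlap_def complex_norm_square)
qed

lemma overlap_row_sum:
  assumes u: "orthonormal_family d u" and w: "orthonormal_family d w" and i: "i < d"
  shows "(\<Sum>j<d. overlap u w i j) = 1"
proof -
  have "complex_of_real (\<Sum>j<d. overlap u w i j) = u i \<bullet>c u i"
    using overlap_complex[OF u w i] parseval[OF w, of "u i" "u i"] u i by simp
  then show ?thesis using orthonormal_familyD[OF u i i] by (simp only: of_real_eq_1_iff simp_thms if_True)
qed

lemma overlap_column_sum:
  assumes u: "orthonormal_family d u" and w: "orthonormal_family d w" and j: "j < d"
  shows "(\<Sum>i<d. overlap u w i j) = 1"
proof -
  have "overlap u w i j = overlap w u j i" if "i < d" for i
  proof -
    have "w j \<bullet>c u i = cnj (u i \<bullet>c w j)"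
      by (rule cscalar_prod_commute[of _ d]) (use u w that j in auto)
    then show ?thesis by (simp add: overlap_def)
  qed
  then show ?thesis using overlap_row_sum[OF w u j] by simp
qed

text \<open>Both sides are the squared Frobenius norm of \<open>S\<close>: expanding one vector by Parseval and moving
  \<open>S\<close> across the inner product exchanges the roles of the bases.\<close>

lemma frobenius_basis_independent:
  assumes S: "self_adjoint d S" and u: "orthonormal_family d u" and w: "orthonormal_family d w"
  shows "(\<Sum>i<d. (S *\<^sub>v u i) \<bullet>c (S *\<^sub>v u i)) = (\<Sum>j<d. (S *\<^sub>v w j) \<bullet>c (S *\<^sub>v w j))"
proof -
  have "(\<Sum>i<d. (S *\<^sub>v u i) \<bullet>c (S *\<^sub>v u i)) =
      (\<Sum>i<d. \<Sum>j<d. ((S *\<^sub>v u i) \<bullet>c w j) * (w j \<bullet>c (S *\<^sub>v u i)))"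
    using S u by (intro sum.cong refl parseval[OF w]) auto
  also have "\<dots> = (\<Sum>i<d. \<Sum>j<d. ((S *\<^sub>v w j) \<bullet>c u i) * (u i \<bullet>c (S *\<^sub>v w j)))"
  proof (intro sum.cong refl)
    fix i j assume "i \<in> {..<d}" "j \<in> {..<d}"
    then have c: "u i \<in> carrier_vec d" "w j \<in> carrier_vec d" using u w by auto
    show "((S *\<^sub>v u i) \<bullet>c w j) * (w j \<bullet>c (S *\<^sub>v u i)) =
        ((S *\<^sub>v w j) \<bullet>c u i) * (u i \<bullet>c (S *\<^sub>v w j))"
      unfolding self_adjoint_cscalar_prod[OF S c] self_adjoint_cscalar_prod[OF S c(2,1)]
      by (rule mult.commute)
  qed
  also have "\<dots> = (\<Sum>j<d. \<Sum>i<d. ((S *\<^sub>v w j) \<bullet>c u i) * (u i \<bullet>c (S *\<^sub>v w j)))"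
    by (rule sum.swap)
  also have "\<dots> = (\<Sum>j<d. (S *\<^sub>v w j) \<bullet>c (S *\<^sub>v w j))"
    using S w by (intro sum.cong refl parseval[OF u, symmetric]) auto
  finally show ?thesis .
qed

lemma frobenius_eigenbasis:
  assumes b: "eigenbasis d S e u"
  shows "(\<Sum>i<d. (S *\<^sub>v u i) \<bullet>c (S *\<^sub>v u i)) = complex_of_real (\<Sum>i<d. (e i)\<^sup>2)"
  unfolding of_real_sum
proof (intro sum.cong refl)
  fix i assume "i \<in> {..<d}"
  then have i: "i < d" by simp
  then have ui: "u i \<in> carrier_vec d" using eigenbasisD(1)[OF b] by simp
  show "(S *\<^sub>v u i) \<bullet>c (S *\<^sub>v u i) = complex_of_real ((e i)\<^sup>2)"
    unfolding eigenbasisD(2)[OF b i]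
    using ui orthonormal_familyD[OF eigenbasisD(1)[OF b] i i]
    by (simp add: cscalar_prod_linear[where d = d] power2_eq_square)
qed

text \<open>Here \<open>\<parallel>(A + B) u\<^sub>i\<parallel>\<^sup>2 = lam\<^sub>i\<^sup>2 + 2 lam\<^sub>i \<langle>B u\<^sub>i, u\<^sub>i\<rangle> + \<parallel>B u\<^sub>i\<parallel>\<^sup>2\<close> is summed over \<open>i\<close>. All terms except
  the mixed one are squared Frobenius norms and hence sums of squared eigenvalues, and
  \<open>\<langle>B u\<^sub>i, u\<^sub>i\<rangle>\<close> is the mean of \<open>mu\<close> weighted by the overlaps.\<close>

lemma overlap_sum_if_spectra_add:
  assumes A: "self_adjoint d A" and B: "self_adjoint d B"
    and u: "eigenbasis d A lam u" and w: "eigenbasis d B mu w" and z: "eigenbasis d (A + B) nu z"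
    and eq: "(\<Sum>i<d. (nu i)\<^sup>2) = (\<Sum>i<d. (lam i + mu i)\<^sup>2)"
  shows "(\<Sum>i<d. \<Sum>j<d. lam i * mu j * overlap u w i j) = (\<Sum>i<d. lam i * mu i)"
proof -
  note ou = eigenbasisD(1)[OF u] and ow = eigenbasisD(1)[OF w] and oz = eigenbasisD(1)[OF z]
  define D where "D i = (\<Sum>j<d. mu j * overlap u w i j)" for i
  have expand: "((A + B) *\<^sub>v u i) \<bullet>c ((A + B) *\<^sub>v u i) =
      complex_of_real ((lam i)\<^sup>2 + 2 * lam i * D i) + (B *\<^sub>v u i) \<bullet>c (B *\<^sub>v u i)"
    if i: "i < d" for i
  proof -
    have ui: "u i \<in> carrier_vec d" using ou i by simp
    have Bu: "B *\<^sub>v u i \<in> carrier_vec d" using B ui by simp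
    have "(B *\<^sub>v u i) \<bullet>c u i = (\<Sum>j<d. ((B *\<^sub>v u i) \<bullet>c w j) * (w j \<bullet>c u i))"
      by (rule parseval[OF ow Bu ui])
    also have "\<dots> = (\<Sum>j<d. complex_of_real (mu j * overlap u w i j))"
    proof (intro sum.cong refl)
      fix j assume "j \<in> {..<d}"
      then have j: "j < d" by simp
      show "((B *\<^sub>v u i) \<bullet>c w j) * (w j \<bullet>c u i) = complex_of_real (mu j * overlap u w i j)"
        using eigenvalue_coefficient[OF B w ui j] overlap_complex[OF ou ow i j]
        by (simp add: mult.assoc)
    qed
    finally have BD: "(B *\<^sub>v u i) \<bullet>c u i = complex_of_real (D i)" by (simp add: D_def)
    have BD': "u i \<bullet>c (B *\<^sub>v u i) = complex_of_real (D i)"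
      using self_adjoint_cscalar_prod[OF B ui ui] BD by simp
    have "(A + B) *\<^sub>v u i = complex_of_real (lam i) \<cdot>\<^sub>v u i + B *\<^sub>v u i"
      using add_mult_distrib_mat_vec[OF self_adjoint_carrier[OF A] self_adjoint_carrier[OF B] ui]
        eigenbasisD(2)[OF u i] by simp
    moreover have "(complex_of_real (lam i) \<cdot>\<^sub>v u i + B *\<^sub>v u i) \<bullet>c
        (complex_of_real (lam i) \<cdot>\<^sub>v u i + B *\<^sub>v u i) =
      complex_of_real ((lam i)\<^sup>2 + 2 * lam i * D i) + (B *\<^sub>v u i) \<bullet>c (B *\<^sub>v u i)"
      using ui Bu BD BD' orthonormal_familyD[OF ou i i]
      by (simp add: cscalar_prod_linear[where d = d] power2_eq_square algebra_simps)
    ultimately show ?thesis by simp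
  qed
  have "complex_of_real (\<Sum>i<d. (lam i + mu i)\<^sup>2) =
      (\<Sum>i<d. ((A + B) *\<^sub>v u i) \<bullet>c ((A + B) *\<^sub>v u i))"
    using frobenius_eigenbasis[OF z] frobenius_basis_independent[OF self_adjoint_add[OF A B] oz ou] eq
    by metis
  also have "\<dots> = (\<Sum>i<d. complex_of_real ((lam i)\<^sup>2 + 2 * lam i * D i) +
      (B *\<^sub>v u i) \<bullet>c (B *\<^sub>v u i))"
    by (intro sum.cong refl expand) simp
  also have "\<dots> = complex_of_real ((\<Sum>i<d. (lam i)\<^sup>2 + 2 * lam i * D i) + (\<Sum>j<d. (mu j)\<^sup>2))"
    unfolding sum.distrib[of "\<lambda>i. complex_of_real (_ i)"] frobenius_basis_independent[OF B ou ow]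
      frobenius_eigenbasis[OF w] by simp
  finally have "(\<Sum>i<d. (lam i + mu i)\<^sup>2) = (\<Sum>i<d. (lam i)\<^sup>2 + 2 * lam i * D i) + (\<Sum>j<d. (mu j)\<^sup>2)"
    by (simp only: of_real_eq_iff)
  then have "2 * (\<Sum>i<d. lam i * mu i) = 2 * (\<Sum>i<d. lam i * D i)"
    by (simp add: power2_sum sum.distrib sum_distrib_left algebra_simps)
  then have "(\<Sum>i<d. lam i * mu i) = (\<Sum>i<d. lam i * D i)"
    by simp
  then show ?thesis
    by (simp add: D_def sum_distrib_left mult.assoc)
qed

section \<open>Matching the two eigenbases\<close>

text \<open>The proof increases \<open>k\<close> while keeping two eigenbases that agree below \<open>k\<close>. The condition on the
  support of the overlaps holds for every pair of eigenbases, so it remains available after each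
  change. Applied to an entry of row \<open>k\<close> and an entry of column \<open>k\<close>, it shows that if \<open>u k\<close> is not
  in the \<open>mu k\<close>-eigenspace of \<open>B\<close> then \<open>w k\<close> is in the \<open>lam k\<close>-eigenspace of \<open>A\<close>.\<close>

lemma common_eigenbasis:
  assumes A: "self_adjoint d A" and B: "self_adjoint d B"
    and u: "eigenbasis d A lam u" and w: "eigenbasis d B mu w" and z: "eigenbasis d (A + B) nu z"
    and lam: "\<And>i j. i \<le> j \<Longrightarrow> j < d \<Longrightarrow> lam j \<le> lam i"
    and mu: "\<And>i j. i \<le> j \<Longrightarrow> j < d \<Longrightarrow> mu i \<le> mu j"
    and eq: "(\<Sum>i<d. (nu i)\<^sup>2) = (\<Sum>i<d. (lam i + mu i)\<^sup>2)"
  obtains v where "eigenbasis d A lam v" "eigenbasis d B mu v"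
proof -
  have "\<exists>u w. eigenbasis d A lam u \<and> eigenbasis d B mu w \<and> (\<forall>i<k. u i = w i)" if "k \<le> d" for k
    using that
  proof (induction k)
    case 0
    then show ?case using u w by auto
  next
    case (Suc k)
    then obtain u w where u: "eigenbasis d A lam u" and w: "eigenbasis d B mu w"
      and same: "\<And>i. i < k \<Longrightarrow> u i = w i" by auto
    have k: "k < d" using Suc by simp
    note ou = eigenbasisD(1)[OF u] and ow = eigenbasisD(1)[OF w]
    have uk: "u k \<in> carrier_vec d" "u k \<bullet>c u k = 1"
      and wk: "w k \<in> carrier_vec d" "w k \<bullet>c w k = 1"
      using ou ow orthonormal_familyD[OF ou k k] orthonormal_familyD[OF ow k k] k by auto
    have u_low: "u k \<bullet>c w j = 0" if "j < k" for j
      using orthonormal_familyD[OF ou k, of j] same[OF that] that k by simp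
    have w_low: "w k \<bullet>c u j = 0" if "j < k" for j
      using orthonormal_familyD[OF ow k, of j] same[OF that] that k by simp
    have exchange: "(lam k - lam i) * (mu j - mu k) \<le> 0"
      if "i < d" "j < d" "w k \<bullet>c u i \<noteq> 0" "u k \<bullet>c w j \<noteq> 0" for i j
    proof -
      have "u i \<bullet>c w k = cnj (w k \<bullet>c u i)"
        by (rule cscalar_prod_commute[OF wk(1)]) (use ou that in simp)
      then have "overlap u w i k \<noteq> 0" "overlap u w k j \<noteq> 0"
        using that by (auto simp: overlap_def)
      then show ?thesis
        using extremal_weights_support[of d lam mu "overlap u w" k j i k] lam mu k that(1,2)
          overlap_row_sum[OF ou ow] overlap_column_sum[OF ou ow]
          overlap_sum_if_spectra_add[OF A B u w z eq]
        by (simp add: overlap_def)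
    qed
    show ?case
    proof (cases "\<forall>j<d. u k \<bullet>c w j \<noteq> 0 \<longrightarrow> mu j = mu k")
      case True
      then have "B *\<^sub>v u k = complex_of_real (mu k) \<cdot>\<^sub>v u k"
        by (intro eigenvector_if_support[OF B w uk(1)]) auto
      then obtain w' where w': "eigenbasis d B mu w'" "w' k = u k"
        and keep: "\<And>j. j < d \<Longrightarrow> j \<noteq> k \<Longrightarrow> u k \<bullet>c w j = 0 \<Longrightarrow> w' j = w j"
        using eigenbasis_replace[OF B w k uk] by metis
      have "u i = w' i" if "i < Suc k" for i
        using that keep[of i] u_low[of i] same[of i] w'(2) k by (cases "i = k") auto
      then show ?thesis using u w'(1) by blast
    next
      case False
      then obtain j where j: "j < d" "u k \<bullet>c w j \<noteq> 0" "mu j \<noteq> mu k" by blast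
      then have "k \<le> j" using u_low[of j] by (meson not_less)
      then have mu_less: "mu k < mu j" using mu[of k j] j by simp
      have "lam i = lam k" if i: "i < d" "w k \<bullet>c u i \<noteq> 0" for i
      proof -
        have "k \<le> i" using w_low[of i] i by (meson not_less)
        then have "lam i \<le> lam k" using lam i by simp
        moreover have "lam k - lam i \<le> 0"
          using exchange[OF i(1) j(1) i(2) j(2)] mu_less by (simp add: mult_le_0_iff)
        ultimately show ?thesis by simp
      qed
      then have "A *\<^sub>v w k = complex_of_real (lam k) \<cdot>\<^sub>v w k"
        by (intro eigenvector_if_support[OF A u wk(1)]) auto
      then obtain u' where u': "eigenbasis d A lam u'" "u' k = w k"
        and keep: "\<And>j. j < d \<Longrightarrow> j \<noteq> k \<Longrightarrow> w k \<bullet>c u j = 0 \<Longrightarrow> u' j = u j"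
        using eigenbasis_replace[OF A u k wk] by metis
      have "u' i = w i" if "i < Suc k" for i
        using that keep[of i] w_low[of i] same[of i] u'(2) k by (cases "i = k") auto
      then show ?thesis using u'(1) w by blast
    qed
  qed
  then obtain u w where u: "eigenbasis d A lam u" and w: "eigenbasis d B mu w"
    and same: "\<forall>i<d. u i = w i" by blast
  have "eigenbasis d B mu u"
    using w same unfolding eigenbasis_def orthonormal_family_def by metis
  then show thesis using u that by blast
qed

section \<open>Spectral decompositions\<close>

lemma finsum_mat_index:
  assumes "finite I" "\<And>i. i \<in> I \<Longrightarrow> M i \<in> carrier_mat d d"
  shows "(\<Oplus>\<^bsub>module_mat TYPE(complex) d d\<^esub>i\<in>I. M i) \<in> carrier_mat d d"
    and "a < d \<Longrightarrow> b < d \<Longrightarrow>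
      (\<Oplus>\<^bsub>module_mat TYPE(complex) d d\<^esub>i\<in>I. M i) $$ (a, b) = (\<Sum>i\<in>I. M i $$ (a, b))"
proof -
  interpret abelian_group "module_mat TYPE(complex) d d"
    by (rule abelian_group_mat)
  have "(\<Oplus>\<^bsub>module_mat TYPE(complex) d d\<^esub>i\<in>I. M i) \<in> carrier_mat d d \<and>
      (a < d \<longrightarrow> b < d \<longrightarrow>
        (\<Oplus>\<^bsub>module_mat TYPE(complex) d d\<^esub>i\<in>I. M i) $$ (a, b) = (\<Sum>i\<in>I. M i $$ (a, b)))"
    using assms
  proof (induction I rule: finite_induct)
    case empty
    then show ?case by (simp add: module_mat_simps)
  next
    case (insert x I)
    then have "M \<in> I \<rightarrow> carrier (module_mat TYPE(complex) d d)"
      and "M x \<in> carrier (module_mat TYPE(complex) d d)"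
      by (auto simp: module_mat_simps)
    then have step: "(\<Oplus>\<^bsub>module_mat TYPE(complex) d d\<^esub>i\<in>insert x I. M i) =
        M x + (\<Oplus>\<^bsub>module_mat TYPE(complex) d d\<^esub>i\<in>I. M i)"
      using insert.hyps by (simp add: finsum_insert module_mat_simps)
    have c: "M x \<in> carrier_mat d d"
        "(\<Oplus>\<^bsub>module_mat TYPE(complex) d d\<^esub>i\<in>I. M i) \<in> carrier_mat d d"
      using insert by auto
    then show ?case
      unfolding step using insert carrier_matD[OF c(1)] carrier_matD[OF c(2)] by auto
  qed
  then show "(\<Oplus>\<^bsub>module_mat TYPE(complex) d d\<^esub>i\<in>I. M i) \<in> carrier_mat d d"
    and "a < d \<Longrightarrow> b < d \<Longrightarrow>
      (\<Oplus>\<^bsub>module_mat TYPE(complex) d d\<^esub>i\<in>I. M i) $$ (a, b) = (\<Sum>i\<in>I. M i $$ (a, b))"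
    by auto
qed

text \<open>Entrywise, \<open>S\<close> is multiplied by the resolution of the identity given by \<open>completeness\<close>.\<close>

lemma spectral_decomposition:
  assumes S: "self_adjoint d S" and b: "eigenbasis d S e v"
  shows "S = (\<Oplus>\<^bsub>module_mat TYPE(complex) d d\<^esub>i\<in>{..<d}.
            complex_of_real (e i) \<cdot>\<^sub>m outer (v i) (v i))" (is "S = ?R")
proof (rule eq_matI)
  note v = eigenbasisD(1)[OF b] and C = self_adjoint_carrier[OF S]
  have outer: "complex_of_real (e i) \<cdot>\<^sub>m outer (v i) (v i) \<in> carrier_mat d d" if "i < d" for i
    using carrier_vecD[OF orthonormal_family_carrier[OF v that]] by (simp add: outer_def)
  have R: "?R \<in> carrier_mat d d"
    by (rule finsum_mat_index) (use outer in auto)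
  then show "dim_row S = dim_row ?R" "dim_col S = dim_col ?R" using C by auto
  fix a c assume "a < dim_row ?R" "c < dim_col ?R"
  then have ac: "a < d" "c < d" using R by auto
  have "S $$ (a, c) = (\<Sum>k<d. S $$ (a, k) * (if k = c then 1 else 0))"
    using ac by (simp add: if_distrib[of "\<lambda>t. _ * t"] cong: if_cong)
  also have "\<dots> = (\<Sum>k<d. \<Sum>i<d. S $$ (a, k) * v i $ k * cnj (v i $ c))"
    using ac completeness[OF v] by (simp flip: sum_distrib_left add: mult.assoc)
  also have "\<dots> = (\<Sum>i<d. \<Sum>k<d. S $$ (a, k) * v i $ k * cnj (v i $ c))"
    by (rule sum.swap)
  also have "\<dots> = (\<Sum>i<d. (S *\<^sub>v v i) $ a * cnj (v i $ c))"
    using ac by (intro sum.cong refl)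
      (simp add: mult_mat_vec_index_sum[OF C] orthonormal_family_carrier[OF v] sum_distrib_right
        del: index_mult_mat_vec)
  also have "\<dots> = (\<Sum>i<d. (complex_of_real (e i) \<cdot>\<^sub>m outer (v i) (v i)) $$ (a, c))"
  proof (intro sum.cong refl)
    fix i assume "i \<in> {..<d}"
    then have i: "i < d" by simp
    show "(S *\<^sub>v v i) $ a * cnj (v i $ c) = (complex_of_real (e i) \<cdot>\<^sub>m outer (v i) (v i)) $$ (a, c)"
      unfolding eigenbasisD(2)[OF b i]
      using ac carrier_vecD[OF orthonormal_family_carrier[OF v i]] by (simp add: outer_def)
  qed
  also have "\<dots> = ?R $$ (a, c)"
    using ac outer by (intro finsum_mat_index(2)[symmetric]) auto
  finally show "S $$ (a, c) = ?R $$ (a, c)" .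
qed

lemma eigenbasis_add:
  assumes A: "self_adjoint d A" and B: "self_adjoint d B"
    and u: "eigenbasis d A lam v" and w: "eigenbasis d B mu v"
  shows "eigenbasis d (A + B) (\<lambda>i. lam i + mu i) v"
  unfolding eigenbasis_def
proof (intro conjI allI impI)
  show "orthonormal_family d v" by (rule eigenbasisD(1)[OF u])
  fix i assume i: "i < d"
  then have v: "v i \<in> carrier_vec d" using eigenbasisD(1)[OF u] by simp
  show "(A + B) *\<^sub>v v i = complex_of_real (lam i + mu i) \<cdot>\<^sub>v v i"
    using add_mult_distrib_mat_vec[OF self_adjoint_carrier[OF A] self_adjoint_carrier[OF B] v]
      eigenbasisD(2)[OF u i] eigenbasisD(2)[OF w i] by (simp add: add_smult_distrib_vec)
qed

lemma sum_squares_if_mset_eq: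
  fixes xs :: "real list"
  assumes "mset xs = mset (map e [0..<d])"
  shows "(\<Sum>i<d. (xs ! i)\<^sup>2) = (\<Sum>i<d. (e i)\<^sup>2)"
proof -
  have len: "length xs = d"
    using mset_eq_length[OF assms] by simp
  have "(\<Sum>i<d. (xs ! i)\<^sup>2) = sum_list (map (\<lambda>x. x\<^sup>2) xs)"
    by (simp add: sum_list_sum_nth len lessThan_atLeast0)
  also have "\<dots> = sum_list (map (\<lambda>x. x\<^sup>2) (map e [0..<d]))"
    using assms by (metis mset_map sum_mset_sum_list)
  also have "\<dots> = (\<Sum>i<d. (e i)\<^sup>2)"
    by (simp add: sum_list_sum_nth lessThan_atLeast0)
  finally show ?thesis .
qed

theorem theorem6p8:
  fixes d :: nat and S0 S1 :: "complex mat" and lam mu :: "real list"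
  assumes "pos_semidef d S0" and "pos_semidef d S1"
    and "optimal_matching S0 S1"
    and "lam = eigvals_decr S0" and "mu = eigvals_incr S1"
  shows "\<exists>v :: nat \<Rightarrow> complex vec.
    orthonormal_basis d v \<and>
    (\<forall>i<d. S0 *\<^sub>v v i = complex_of_real (lam ! i) \<cdot>\<^sub>v v i) \<and>
    S1 = (\<Oplus>\<^bsub>module_mat TYPE(complex) d d\<^esub>i\<in>{..<d}.
            complex_of_real (mu ! i) \<cdot>\<^sub>m outer (v i) (v i)) \<and>
    S0 + S1 = (\<Oplus>\<^bsub>module_mat TYPE(complex) d d\<^esub>i\<in>{..<d}.
            complex_of_real (lam ! i + mu ! i) \<cdot>\<^sub>m outer (v i) (v i))"
proof -
  have S0: "self_adjoint d S0" and S1: "self_adjoint d S1"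
    using assms by (auto simp: pos_semidef_def)
  note S = self_adjoint_add[OF S0 S1]
  define nu where "nu = eigvals_decr (S0 + S1)"
  have len: "length lam = d" "length mu = d" "length nu = d"
    using length_eigvals self_adjoint_carrier[OF S0] self_adjoint_carrier[OF S1]
      self_adjoint_carrier[OF S] by (auto simp: assms(4,5) nu_def)
  obtain u where u: "eigenbasis d S0 ((!) lam) u"
    using spectral_theorem_ordered[OF S0, of lam] by (auto simp: assms(4) eigvals_decr_def)
  obtain w where w: "eigenbasis d S1 ((!) mu) w"
    using spectral_theorem_ordered[OF S1, of mu] by (auto simp: assms(5))
  obtain z where z: "eigenbasis d (S0 + S1) ((!) nu) z"
    using spectral_theorem_ordered[OF S, of nu] by (auto simp: nu_def eigvals_decr_def)
  have mu_mono: "mu ! i \<le> mu ! j" if "i \<le> j" "j < d" for i j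
    using that len(2) by (intro sorted_nth_mono) (auto simp: assms(5) eigvals_incr_def)
  have lam_mono: "lam ! j \<le> lam ! i" if "i \<le> j" "j < d" for i j
    using that len(1) by (intro sorted_rev_nth_mono) (auto simp: assms(4) eigvals_decr_def eigvals_incr_def)
  have "nu = decr_rearr (map2 (+) lam mu)"
    using assms(3-5) by (simp add: nu_def optimal_matching_def)
  then have "mset nu = mset (map2 (+) lam mu)"
    by (simp add: decr_rearr_def)
  also have "map2 (+) lam mu = map (\<lambda>i. lam ! i + mu ! i) [0..<d]"
    using len by (intro nth_equalityI) auto
  finally have "(\<Sum>i<d. (nu ! i)\<^sup>2) = (\<Sum>i<d. (lam ! i + mu ! i)\<^sup>2)"
    by (rule sum_squares_if_mset_eq)
  then obtain v where v: "eigenbasis d S0 ((!) lam) v" "eigenbasis d S1 ((!) mu) v"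
    using common_eigenbasis[OF S0 S1 u w z lam_mono mu_mono] by blast
  show ?thesis
  proof (intro exI[of _ v] conjI)
    show "orthonormal_basis d v"
      by (rule orthonormal_family_basis[OF eigenbasisD(1)[OF v(1)]])
    show "\<forall>i<d. S0 *\<^sub>v v i = complex_of_real (lam ! i) \<cdot>\<^sub>v v i"
      using eigenbasisD(2)[OF v(1)] by blast
    show "S1 = (\<Oplus>\<^bsub>module_mat TYPE(complex) d d\<^esub>i\<in>{..<d}.
        complex_of_real (mu ! i) \<cdot>\<^sub>m outer (v i) (v i))"
      by (rule spectral_decomposition[OF S1 v(2)])
    show "S0 + S1 = (\<Oplus>\<^bsub>module_mat TYPE(complex) d d\<^esub>i\<in>{..<d}.
        complex_of_real (lam ! i + mu ! i) \<cdot>\<^sub>m outer (v i) (v i))"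
      by (rule spectral_decomposition[OF S eigenbasis_add[OF S0 S1 v]])
  qed
qed

end
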